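(* Let $x>1$ and let $f,g,h$ be positive and continuous functions on $[1,\infty)$ such that $$(g(\tau)-g(\sigma))\left(\frac{f(\sigma)}{h(\sigma)}-\frac{f(\tau)}{h(\tau)}\right)\ge 0\quad\text{for all }\tau,\sigma\in(1,x).$$ Then for all $\alpha,\phi>0$ and $\beta,\varphi\in(0,1]$, $$\frac{\mathcal{H}^{\alpha,\beta}_{1,x}[f(x)]\,\mathcal{H}^{\phi,\varphi}_{1,x}[(gh)(x)]+\mathcal{H}^{\phi,\varphi}_{1,x}[f(x)]\,\mathcal{H}^{\alpha,\beta}_{1,x}[(gh)(x)]}{\mathcal{H}^{\alpha,\beta}_{1,x}[h(x)]\,\mathcal{H}^{\phi,\varphi}_{1,x}[(gf)(x)]+\mathcal{H}^{\phi,\varphi}_{1,x}[h(x)]\,\mathcal{H}^{\alpha,\beta}_{1,x}[(gf)(x)]}\ge 1.$$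
   Context: For $\alpha>0$, $\beta\in(0,1]$ and $x>1$, the one-sided generalized proportional Hadamard fractional integral of a function $z$ on $[1,\infty)$ is $$\mathcal{H}^{\alpha,\beta}_{1,x}[z(x)]=(\mathcal{H}^{\alpha,\beta}_{1,x}z)(x)=\frac{1}{\beta^{\alpha}\Gamma(\alpha)}\int_{1}^{x}e^{\frac{\beta-1}{\beta}(\ln x-\ln t)}(\ln x-\ln t)^{\alpha-1}\frac{z(t)}{t}\,dt,$$ where $\Gamma$ is the gamma function; $\mathcal{H}^{\phi,\varphi}_{1,x}$ is the same operator with order $\phi$ and proportionality index $\varphi$. Here $(gf)(x)=g(x)f(x)$ is the pointwise product. *)

theory Defs
  imports "HOL-Analysis.Analysis"
begin

text \<open>
  For \<open>\<alpha> < 1\<close> the kernel is unbounded as \<open>t\<close> tends to \<open>x\<close>, so the integral is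
  a Lebesgue integral. At \<open>t = x\<close> itself \<open>0 powr (\<alpha> - 1) = 0\<close> by convention (also for
  \<open>\<alpha> = 1\<close>); this value on a null set does not affect the integral.
\<close>

definition prop_hadamard_integral :: "real \<Rightarrow> real \<Rightarrow> (real \<Rightarrow> real) \<Rightarrow> real \<Rightarrow> real" where
  "prop_hadamard_integral \<alpha> \<beta> z x =
     1 / (\<beta> powr \<alpha> * Gamma \<alpha>) *
     (LBINT t:{1..x}. exp ((\<beta> - 1) / \<beta> * (ln x - ln t)) * (ln x - ln t) powr (\<alpha> - 1) * (z t / t))"

end

theory Submission
  imports Defs
begin

text \<open>
  Clearing the positive denominators, the hypothesis says that for all \<open>\<tau>, \<sigma>\<close> in the open interval
  \<open>f \<sigma> * (g \<tau> * h \<tau>) + (g \<sigma> * h \<sigma>) * f \<tau> \<ge> h \<sigma> * (g \<tau> * f \<tau>) + (g \<sigma> * f \<sigma>) * h \<tau>\<close>.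
  Every term is a function of \<open>\<sigma>\<close> times a function of \<open>\<tau>\<close>, so integrating in \<open>\<sigma>\<close> against the kernel
  of order \<open>\<alpha>\<close> and then in \<open>\<tau>\<close> against the kernel of order \<open>\<phi>\<close> turns it into the inequality
  between the numerator and the denominator of the claim. Since the variables separate, the iterated
  integral is evaluated by linearity alone; this is \<open>chebyshev_two_weights\<close>.

  What remains is analytic: both kernels must be integrable against continuous functions although
  they blow up at the right endpoint for orders below one (\<open>integrable_kernel_times_continuous\<close>),
  and the denominator must be strictly positive (\<open>prop_hadamard_integral_pos\<close>), because a quotient
  by zero would be zero.
\<close>

text \<open>The weight \<open>u\<close> is integrated out first, with \<open>\<tau>\<close> a parameter; the result is a combination of
  functions of \<open>\<tau>\<close> with constant coefficients, nonnegative on \<open>S\<close>, to which the same argument applies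
  with \<open>v\<close>. The two weights are allowed to differ, which is what makes the sides symmetrised sums rather
  than plain products as in the classical Chebyshev inequality.\<close>

lemma chebyshev_two_weights:
  fixes f g h u v :: "'a \<Rightarrow> real"
  assumes u_nonneg: "\<And>t. t \<in> S \<Longrightarrow> u t \<ge> 0" and v_nonneg: "\<And>t. t \<in> S \<Longrightarrow> v t \<ge> 0"
    and h_pos: "\<And>t. t \<in> S \<Longrightarrow> h t > 0"
    and anti: "\<And>\<tau> \<sigma>. \<tau> \<in> S \<Longrightarrow> \<sigma> \<in> S \<Longrightarrow> (g \<tau> - g \<sigma>) * (f \<sigma> / h \<sigma> - f \<tau> / h \<tau>) \<ge> 0"
    and u_int: "set_integrable M S (\<lambda>t. u t * f t)" "set_integrable M S (\<lambda>t. u t * h t)"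
      "set_integrable M S (\<lambda>t. u t * (g t * f t))" "set_integrable M S (\<lambda>t. u t * (g t * h t))"
    and v_int: "set_integrable M S (\<lambda>t. v t * f t)" "set_integrable M S (\<lambda>t. v t * h t)"
      "set_integrable M S (\<lambda>t. v t * (g t * f t))" "set_integrable M S (\<lambda>t. v t * (g t * h t))"
  shows "(LINT t:S|M. u t * h t) * (LINT t:S|M. v t * (g t * f t))
        + (LINT t:S|M. v t * h t) * (LINT t:S|M. u t * (g t * f t))
      \<le> (LINT t:S|M. u t * f t) * (LINT t:S|M. v t * (g t * h t))
        + (LINT t:S|M. v t * f t) * (LINT t:S|M. u t * (g t * h t))"
proof -
  define U where "U z = (LINT t:S|M. u t * z t)" for z
  define V where "V z = (LINT t:S|M. v t * z t)" for z
  have kernel: "f \<sigma> * (g \<tau> * h \<tau>) + (g \<sigma> * h \<sigma>) * f \<tau> - h \<sigma> * (g \<tau> * f \<tau>) - (g \<sigma> * f \<sigma>) * h \<tau> \<ge> 0"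
    if "\<sigma> \<in> S" "\<tau> \<in> S" for \<sigma> \<tau>
  proof -
    have "0 \<le> h \<sigma> * h \<tau> * ((g \<tau> - g \<sigma>) * (f \<sigma> / h \<sigma> - f \<tau> / h \<tau>))"
      using anti[OF that(2,1)] h_pos[OF that(1)] h_pos[OF that(2)] by simp
    also have "\<dots> = (g \<tau> - g \<sigma>) * (f \<sigma> * h \<tau> - f \<tau> * h \<sigma>)"
      using h_pos[OF that(1)] h_pos[OF that(2)] by (simp add: field_simps)
    finally show ?thesis by (simp add: algebra_simps)
  qed
  have inner: "U f * (g \<tau> * h \<tau>) + U (\<lambda>t. g t * h t) * f \<tau>
      - U h * (g \<tau> * f \<tau>) - U (\<lambda>t. g t * f t) * h \<tau> \<ge> 0" if "\<tau> \<in> S" for \<tau>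
  proof -
    have "0 \<le> (LINT \<sigma>:S|M. (u \<sigma> * f \<sigma>) * (g \<tau> * h \<tau>) + (u \<sigma> * (g \<sigma> * h \<sigma>)) * f \<tau>
        - (u \<sigma> * h \<sigma>) * (g \<tau> * f \<tau>) - (u \<sigma> * (g \<sigma> * f \<sigma>)) * h \<tau>)"
      unfolding set_lebesgue_integral_def
    proof (rule Bochner_Integration.integral_nonneg, goal_cases)
      case (1 \<sigma>)
      show ?case
      proof (cases "\<sigma> \<in> S")
        case True
        have "0 \<le> u \<sigma> * (f \<sigma> * (g \<tau> * h \<tau>) + (g \<sigma> * h \<sigma>) * f \<tau>
            - h \<sigma> * (g \<tau> * f \<tau>) - (g \<sigma> * f \<sigma>) * h \<tau>)"
          using kernel[OF True that] u_nonneg[OF True] by simp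
        then show ?thesis using True by (simp add: algebra_simps)
      qed simp
    qed
    also have "\<dots> = U f * (g \<tau> * h \<tau>) + U (\<lambda>t. g t * h t) * f \<tau>
      - U h * (g \<tau> * f \<tau>) - U (\<lambda>t. g t * f t) * h \<tau>"
      unfolding U_def
      by (simp only: set_integral_add set_integral_diff set_integral_mult_left
          set_integrable_mult_left u_int simp_thms)
    finally show ?thesis .
  qed
  have "0 \<le> (LINT \<tau>:S|M. U f * (v \<tau> * (g \<tau> * h \<tau>)) + U (\<lambda>t. g t * h t) * (v \<tau> * f \<tau>)
      - U h * (v \<tau> * (g \<tau> * f \<tau>)) - U (\<lambda>t. g t * f t) * (v \<tau> * h \<tau>))"
    unfolding set_lebesgue_integral_def
  proof (rule Bochner_Integration.integral_nonneg, goal_cases)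
    case (1 \<tau>)
    show ?case
    proof (cases "\<tau> \<in> S")
      case True
      have "0 \<le> v \<tau> * (U f * (g \<tau> * h \<tau>) + U (\<lambda>t. g t * h t) * f \<tau>
          - U h * (g \<tau> * f \<tau>) - U (\<lambda>t. g t * f t) * h \<tau>)"
        using inner[OF True] v_nonneg[OF True] by simp
      then show ?thesis using True by (simp add: algebra_simps)
    qed simp
  qed
  also have "\<dots> = U f * V (\<lambda>t. g t * h t) + U (\<lambda>t. g t * h t) * V f
      - U h * V (\<lambda>t. g t * f t) - U (\<lambda>t. g t * f t) * V h"
    unfolding V_def
    by (simp only: set_integral_add set_integral_diff set_integral_mult_right
        set_integrable_mult_right v_int simp_thms)
  finally show ?thesis by (simp add: U_def V_def mult.commute)
qed

definition hadamard_kernel :: "real \<Rightarrow> real \<Rightarrow> real \<Rightarrow> real \<Rightarrow> real" where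
  "hadamard_kernel \<alpha> \<beta> x t =
     exp ((\<beta> - 1) / \<beta> * (ln x - ln t)) * (ln x - ln t) powr (\<alpha> - 1) / t"

text \<open>The endpoints are dropped because the monotonicity hypothesis on \<open>g\<close> and \<open>f / h\<close> is imposed
  on the open interval only.\<close>

lemma prop_hadamard_integral_eq_kernel:
  "prop_hadamard_integral \<alpha> \<beta> z x =
     1 / (\<beta> powr \<alpha> * Gamma \<alpha>) * (LBINT t:{1<..<x}. hadamard_kernel \<alpha> \<beta> x t * z t)"
proof -
  have "(LBINT t:{1..x}. hadamard_kernel \<alpha> \<beta> x t * z t)
      = (LBINT t:{1<..<x}. hadamard_kernel \<alpha> \<beta> x t * z t)"
    by (rule set_integral_discrete_difference[where X = "{1, x}"]) auto
  then show ?thesis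
    by (simp add: prop_hadamard_integral_def hadamard_kernel_def)
qed

text \<open>The integrand is nonnegative and has the antiderivative \<open>- (ln x - ln t) powr \<alpha> / \<alpha>\<close>, which is
  continuous up to \<open>t = x\<close> because \<open>\<alpha>\<close> is positive.\<close>

lemma integrable_log_singularity:
  fixes x \<alpha> :: real
  assumes "x > 1" "\<alpha> > 0"
  shows "set_integrable lborel {1<..<x} (\<lambda>t. (ln x - ln t) powr (\<alpha> - 1) / t)"
proof -
  define k where "k t = (ln x - ln t) powr (\<alpha> - 1) / t" for t
  define K where "K t = - ((ln x - ln t) powr \<alpha> / \<alpha>)" for t
  have "continuous_on {1..x} K"
    unfolding K_def using assms
    by (intro continuous_on_minus continuous_on_divide continuous_on_powr' continuous_on_diff
        continuous_on_ln continuous_on_const continuous_on_id) auto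
  moreover have "(K has_vector_derivative k t) (at t)" if "t \<in> {1<..<x}" for t
    unfolding has_real_derivative_iff_has_vector_derivative[symmetric] K_def k_def
    using that assms by (auto intro!: derivative_eq_intros simp: field_simps)
  ultimately have "(k has_integral (K x - K 1)) {1..x}"
    using assms by (intro fundamental_theorem_of_calculus_interior) auto
  then have "k absolutely_integrable_on {1..x}"
    using assms by (intro nonnegative_absolutely_integrable_1) (auto simp: k_def integrable_on_def)
  then have "k absolutely_integrable_on {1<..<x}"
    by (rule set_integrable_subset) auto
  then have "set_integrable lborel {1<..<x} k"
    unfolding set_integrable_def
    by (subst (asm) integrable_completion) (simp_all add: k_def)
  then show ?thesis by (simp add: k_def[abs_def])
qed

text \<open>The exponential factor and \<open>z\<close> are bounded on the compact interval, so the singular factor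
  times a constant dominates the integrand.\<close>

lemma integrable_kernel_times_continuous:
  fixes z :: "real \<Rightarrow> real"
  assumes "x > 1" "\<alpha> > 0" and z: "continuous_on {1..x} z"
  shows "set_integrable lborel {1<..<x} (\<lambda>t. hadamard_kernel \<alpha> \<beta> x t * z t)"
proof -
  define w where "w t = exp ((\<beta> - 1) / \<beta> * (ln x - ln t)) * z t" for t
  have w: "continuous_on {1..x} w"
    unfolding w_def using z assms by (intro continuous_intros) auto
  have "bounded (w ` {1..x})"
    by (rule compact_imp_bounded[OF compact_continuous_image[OF w compact_Icc]])
  then obtain B where B: "\<And>t. t \<in> {1..x} \<Longrightarrow> \<bar>w t\<bar> \<le> B"
    by (metis bounded_iff imageI real_norm_def)
  have "continuous_on {1<..<x} w"
    using w by (rule continuous_on_subset) auto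
  then have w_meas: "(\<lambda>t. indicator {1<..<x} t *\<^sub>R w t) \<in> borel_measurable borel"
    by (intro borel_measurable_continuous_on_indicator) auto
  have "set_integrable lborel {1<..<x} (\<lambda>t. B * ((ln x - ln t) powr (\<alpha> - 1) / t))"
    using integrable_log_singularity[OF assms(1,2)] by (intro set_integrable_mult_right)
  then have "integrable lborel (\<lambda>t. (indicator {1<..<x} t *\<^sub>R w t) * ((ln x - ln t) powr (\<alpha> - 1) / t))"
    unfolding set_integrable_def
  proof (rule Bochner_Integration.integrable_bound)
    show "(\<lambda>t. (indicator {1<..<x} t *\<^sub>R w t) * ((ln x - ln t) powr (\<alpha> - 1) / t)) \<in> borel_measurable lborel"
      using w_meas by simp
    show "AE t in lborel. norm ((indicator {1<..<x} t *\<^sub>R w t) * ((ln x - ln t) powr (\<alpha> - 1) / t))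
        \<le> norm (indicator {1<..<x} t *\<^sub>R (B * ((ln x - ln t) powr (\<alpha> - 1) / t)))"
    proof (rule AE_I2)
      fix t
      show "norm ((indicator {1<..<x} t *\<^sub>R w t) * ((ln x - ln t) powr (\<alpha> - 1) / t))
        \<le> norm (indicator {1<..<x} t *\<^sub>R (B * ((ln x - ln t) powr (\<alpha> - 1) / t)))"
        using B[of t] by (cases "t \<in> {1<..<x}") (auto simp: abs_mult intro!: divide_right_mono mult_right_mono)
    qed
  qed
  then show ?thesis
    unfolding set_integrable_def
    by (rule back_subst[where P = "integrable lborel"])
       (auto simp: hadamard_kernel_def w_def fun_eq_iff)
qed

text \<open>A nonnegative integrand with vanishing integral is zero almost everywhere, whereas this one is
  strictly positive on an interval of positive length.\<close>

lemma prop_hadamard_integral_pos: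
  assumes "x > 1" "\<alpha> > 0" "\<beta> > 0" and z: "continuous_on {1..x} z"
    and z_pos: "\<And>t. t \<in> {1<..<x} \<Longrightarrow> z t > 0"
  shows "prop_hadamard_integral \<alpha> \<beta> z x > 0"
proof -
  define F where "F t = indicator {1<..<x} t *\<^sub>R (hadamard_kernel \<alpha> \<beta> x t * z t)" for t
  have F_int: "integrable lborel F"
    using integrable_kernel_times_continuous[OF assms(1,2) z, of \<beta>]
    unfolding set_integrable_def F_def .
  have F_pos: "F t > 0" if "t \<in> {1<..<x}" for t
    using that z_pos[OF that] by (auto simp: F_def hadamard_kernel_def)
  have F_nonneg: "F t \<ge> 0" for t
    using F_pos[of t] by (cases "t \<in> {1<..<x}") (auto simp: F_def)
  have "integral\<^sup>L lborel F \<noteq> 0"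
  proof
    assume "integral\<^sup>L lborel F = 0"
    then have "AE t in lborel. F t = 0"
      using integral_nonneg_eq_0_iff_AE[OF F_int] F_nonneg by simp
    then have "AE t in lborel. t \<notin> {1<..<x}"
      by eventually_elim (use F_pos in force)
    then have "{1<..<x} \<in> null_sets lborel"
      by (subst AE_iff_null_sets) auto
    then show False
      using \<open>x > 1\<close> by (simp add: null_sets_def)
  qed
  moreover have "integral\<^sup>L lborel F \<ge> 0"
    using F_nonneg by simp
  ultimately show ?thesis
    using assms Gamma_real_pos[of \<alpha>]
    by (simp add: prop_hadamard_integral_eq_kernel set_lebesgue_integral_def F_def[abs_def])
qed

theorem theorem4p6:
  fixes x :: real and f g h :: "real \<Rightarrow> real"
  assumes "x > 1"
    and "continuous_on {1..} f" and "continuous_on {1..} g" and "continuous_on {1..} h"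
    and "\<And>t. t \<ge> 1 \<Longrightarrow> f t > 0" and "\<And>t. t \<ge> 1 \<Longrightarrow> g t > 0" and "\<And>t. t \<ge> 1 \<Longrightarrow> h t > 0"
    and "\<And>\<tau> \<sigma>. \<tau> \<in> {1<..<x} \<Longrightarrow> \<sigma> \<in> {1<..<x} \<Longrightarrow>
           (g \<tau> - g \<sigma>) * (f \<sigma> / h \<sigma> - f \<tau> / h \<tau>) \<ge> 0"
  shows "\<forall>\<alpha> \<phi> \<beta> \<psi> :: real. \<alpha> > 0 \<longrightarrow> \<phi> > 0 \<longrightarrow> \<beta> \<in> {0<..1} \<longrightarrow> \<psi> \<in> {0<..1} \<longrightarrow>
      (prop_hadamard_integral \<alpha> \<beta> f x * prop_hadamard_integral \<phi> \<psi> (\<lambda>t. g t * h t) x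
        + prop_hadamard_integral \<phi> \<psi> f x * prop_hadamard_integral \<alpha> \<beta> (\<lambda>t. g t * h t) x)
      / (prop_hadamard_integral \<alpha> \<beta> h x * prop_hadamard_integral \<phi> \<psi> (\<lambda>t. g t * f t) x
        + prop_hadamard_integral \<phi> \<psi> h x * prop_hadamard_integral \<alpha> \<beta> (\<lambda>t. g t * f t) x)
      \<ge> 1"
proof (intro allI impI)
  fix \<alpha> \<phi> \<beta> \<psi> :: real
  assume par: "\<alpha> > 0" "\<phi> > 0" "\<beta> \<in> {0<..1}" "\<psi> \<in> {0<..1}"
  have cont: "continuous_on {1..x} f" "continuous_on {1..x} g" "continuous_on {1..x} h"
    by (rule continuous_on_subset[OF assms(2)] continuous_on_subset[OF assms(3)]
        continuous_on_subset[OF assms(4)]; auto)+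
  define c where "c = 1 / (\<beta> powr \<alpha> * Gamma \<alpha>)"
  define d where "d = 1 / (\<psi> powr \<phi> * Gamma \<phi>)"
  define U where "U z = (LBINT t:{1<..<x}. hadamard_kernel \<alpha> \<beta> x t * z t)" for z
  define V where "V z = (LBINT t:{1<..<x}. hadamard_kernel \<phi> \<psi> x t * z t)" for z
  have "c > 0" "d > 0"
    using par Gamma_real_pos[of \<alpha>] Gamma_real_pos[of \<phi>] by (auto simp: c_def d_def)
  have eq: "prop_hadamard_integral \<alpha> \<beta> z x = c * U z" "prop_hadamard_integral \<phi> \<psi> z x = d * V z" for z
    by (simp_all add: prop_hadamard_integral_eq_kernel c_def d_def U_def V_def)
  have le: "U h * V (\<lambda>t. g t * f t) + V h * U (\<lambda>t. g t * f t)
      \<le> U f * V (\<lambda>t. g t * h t) + V f * U (\<lambda>t. g t * h t)"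
    unfolding U_def V_def using assms par cont
    by (intro chebyshev_two_weights integrable_kernel_times_continuous continuous_on_mult)
       (auto simp: hadamard_kernel_def)
  have pos: "prop_hadamard_integral a b z x > 0"
    if "a > 0" "b > 0" "z \<in> {h, \<lambda>t. g t * f t}" for a b z
    using that assms cont
    by (intro prop_hadamard_integral_pos) (auto intro!: continuous_on_mult)
  let ?N = "prop_hadamard_integral \<alpha> \<beta> f x * prop_hadamard_integral \<phi> \<psi> (\<lambda>t. g t * h t) x
        + prop_hadamard_integral \<phi> \<psi> f x * prop_hadamard_integral \<alpha> \<beta> (\<lambda>t. g t * h t) x"
  let ?D = "prop_hadamard_integral \<alpha> \<beta> h x * prop_hadamard_integral \<phi> \<psi> (\<lambda>t. g t * f t) x
        + prop_hadamard_integral \<phi> \<psi> h x * prop_hadamard_integral \<alpha> \<beta> (\<lambda>t. g t * f t) x"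
  have "?D > 0"
    using par by (intro add_pos_pos mult_pos_pos pos) auto
  moreover have "?D \<le> ?N"
    using mult_left_mono[OF le, of "c * d"] \<open>c > 0\<close> \<open>d > 0\<close> by (simp add: eq algebra_simps)
  ultimately show "?N / ?D \<ge> 1"
    by simp
qed

end
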